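(* For every integer $n\ge 1$, $$\psi_{sq}(G_{2,n})=\beta_2(G_{2,n})=2\left\lceil\frac n2\right\rceil.$$
   Context: All graphs are finite, simple and undirected. $G_{2,n}=P_2\square P_n$ is the $2\times n$ grid graph (ladder), $P_k$ being the path on $k$ vertices. $N_G[v]$ denotes the closed neighborhood of $v$ in $G$. A sub-quorum coloring of $G$ with $k$ colors is an onto partial map $f:V(G)\dashrightarrow\{1,\ldots,k\}$ such that, with $S=\operatorname{dom}(f)$, every $v\in S$ satisfies $|\{u\in N_G[v]\cap S: f(u)=f(v)\}|\ge\frac12|N_G[v]\cap S|$; $\psi_{sq}(G)$ is the maximum such $k$. A set $S\subseteq V(G)$ is $2$-independent if the induced subgraph $G[S]$ has maximum degree at most $1$; $\beta_2(G)$ is the maximum cardinality of a $2$-independent set. *)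

theory Defs
  imports Complex_Main "Graph_Theory.Pair_Digraph" "Graph_Theory.Digraph_Component"
begin

text \<open>
  Finite simple undirected graphs are the instances of the locale \<^locale>\<open>pair_graph\<close>:
  an edge $uv$ is represented by the two arcs $(u,v)$ and $(v,u)$, so that the degree of a vertex
  is its out-degree.
\<close>

definition path_graph :: "nat \<Rightarrow> nat pair_pre_digraph" where
  "path_graph k =
    \<lparr> pverts = {1..k}, parcs = {(i, j). i \<in> {1..k} \<and> j \<in> {1..k} \<and> (j = i + 1 \<or> i = j + 1)} \<rparr>"

definition cartesian_product ::
    "'a pair_pre_digraph \<Rightarrow> 'b pair_pre_digraph \<Rightarrow> ('a \<times> 'b) pair_pre_digraph" where
  "cartesian_product G H =
    \<lparr> pverts = pverts G \<times> pverts H,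
      parcs = {((a, b), (c, d)).
        a = c \<and> a \<in> pverts G \<and> (b, d) \<in> parcs H \<or>
        (a, c) \<in> parcs G \<and> b = d \<and> b \<in> pverts H} \<rparr>"

definition grid_graph :: "nat \<Rightarrow> nat \<Rightarrow> (nat \<times> nat) pair_pre_digraph" where
  "grid_graph m n = cartesian_product (path_graph m) (path_graph n)"

definition closed_neighborhood :: "'a pair_pre_digraph \<Rightarrow> 'a \<Rightarrow> 'a set" where
  "closed_neighborhood G v = {v} \<union> {u \<in> pverts G. (v, u) \<in> parcs G}"

definition sub_quorum_coloring ::
    "'a pair_pre_digraph \<Rightarrow> nat \<Rightarrow> ('a \<rightharpoonup> nat) \<Rightarrow> bool" where
  "sub_quorum_coloring G k f \<longleftrightarrow>
    dom f \<subseteq> pverts G \<and> ran f = {1..k} \<and>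
    (\<forall>v \<in> dom f.
      real (card {u \<in> closed_neighborhood G v \<inter> dom f. f u = f v})
        \<ge> 1 / 2 * real (card (closed_neighborhood G v \<inter> dom f)))"

definition sub_quorum_number :: "'a pair_pre_digraph \<Rightarrow> nat" where
  "sub_quorum_number G = Max {k. \<exists>f. sub_quorum_coloring G k f}"

definition two_independent :: "'a pair_pre_digraph \<Rightarrow> 'a set \<Rightarrow> bool" where
  "two_independent G S \<longleftrightarrow>
    S \<subseteq> pverts G \<and> (\<forall>v \<in> S. out_degree (with_proj G \<restriction> S) v \<le> 1)"

definition two_independence_number :: "'a pair_pre_digraph \<Rightarrow> nat" where
  "two_independence_number G = Max {card S | S. two_independent G S}"

lemma pair_graph_path_graph: "pair_graph (path_graph k)"
proof
  have "parcs (path_graph k) \<subseteq> {1..k} \<times> {1..k}"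
    by (auto simp: path_graph_def)
  then show "finite (parcs (path_graph k))"
    by (rule finite_subset) simp
qed (auto simp: path_graph_def symmetric_def sym_def)

lemma pair_graph_cartesian_product:
  assumes "pair_graph G" "pair_graph H"
  shows "pair_graph (cartesian_product G H)"
proof -
  interpret G: pair_graph G by fact
  interpret H: pair_graph H by fact
  show ?thesis
  proof
    have "parcs (cartesian_product G H)
        \<subseteq> (pverts G \<times> pverts H) \<times> (pverts G \<times> pverts H)"
      by (auto simp: cartesian_product_def dest: G.wellformed' H.wellformed')
    then show "finite (parcs (cartesian_product G H))"
      by (rule finite_subset) (simp add: G.pair_finite_verts H.pair_finite_verts)
    show "finite (pverts (cartesian_product G H))"
      by (simp add: cartesian_product_def G.pair_finite_verts H.pair_finite_verts)
    show "symmetric (with_proj (cartesian_product G H))"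
      by (auto simp: symmetric_def sym_def cartesian_product_def
          dest: G.arcs_symmetric H.arcs_symmetric)
  qed (auto simp: cartesian_product_def
        dest: G.wellformed' H.wellformed' G.no_loops' H.no_loops')
qed

lemma pair_graph_grid_graph: "pair_graph (grid_graph m n)"
  unfolding grid_graph_def by (intro pair_graph_cartesian_product pair_graph_path_graph)

text \<open>On finite graphs both maxima range over finite nonempty sets.\<close>

lemma sub_quorum_coloring_le:
  assumes "finite (pverts G)" "sub_quorum_coloring G k f"
  shows "k \<le> card (pverts G)"
proof -
  have fin: "finite (dom f)" and sub: "dom f \<subseteq> pverts G"
    using assms finite_subset by (auto simp: sub_quorum_coloring_def)
  have "ran f = (the \<circ> f) ` dom f"
    by (force simp: ran_def dom_def)
  then have "card (ran f) \<le> card (dom f)"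
    using fin by (simp add: card_image_le)
  then show ?thesis
    using assms card_mono[OF assms(1) sub] by (simp add: sub_quorum_coloring_def)
qed

lemma finite_sub_quorum_colors:
  assumes "finite (pverts G)"
  shows "finite {k. \<exists>f. sub_quorum_coloring G k f}"
proof (rule finite_subset)
  show "{k. \<exists>f. sub_quorum_coloring G k f} \<subseteq> {..card (pverts G)}"
    using sub_quorum_coloring_le[OF assms] by auto
qed simp

lemma sub_quorum_colors_nonempty: "{k. \<exists>f. sub_quorum_coloring G k f} \<noteq> {}"
proof -
  have "sub_quorum_coloring G 0 Map.empty"
    by (simp add: sub_quorum_coloring_def)
  then show ?thesis by blast
qed

lemma finite_two_independent_cards:
  assumes "finite (pverts G)"
  shows "finite {card S | S. two_independent G S}"
proof -
  have "{card S | S. two_independent G S} \<subseteq> card ` Pow (pverts G)"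
    by (auto simp: two_independent_def)
  then show ?thesis
    by (rule finite_subset) (simp add: assms)
qed

lemma two_independent_cards_nonempty: "{card S | S. two_independent G S} \<noteq> {}"
proof -
  have "two_independent G {}"
    by (simp add: two_independent_def)
  then show ?thesis by blast
qed

end

theory Submission
  imports Defs
begin

text \<open>
  Giving the vertices of a $2$-independent set distinct colors is a sub-quorum coloring, because
  one color-mate (the vertex itself) suffices among at most two colored vertices. So
  $\beta_2(G) \le \psi_{sq}(G)$ for every graph $G$, and the heart of the matter is the converse
  inequality for ladders.

  In a graph of maximum degree at most $3$ the sub-quorum condition says just this: every colored
  vertex with at least two colored neighbors has a neighbor of its own color, a friend. Among all
  colorings with $k$ colors choose one with the fewest colored vertices. Erasing a vertex $v$ whose
  color occurs elsewhere must break the condition, and it can do so only at a friend $u$ of $v$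
  that has three colored neighbors and no friend but $v$
  (\<open>minimal_coloring_critical_friend\<close>). Then $v$ and $u$ play symmetric roles. It follows
  that every colored vertex with at least two colored neighbors has three, and so has one of those
  neighbors
  (\<open>minimal_coloring_degree_two_imp_three\<close>).

  In a ladder this is impossible (\<open>ladder_no_degree_three_cluster\<close>). Take such a vertex in
  the leftmost possible column. The other vertex of that column and the vertices to the left and
  right are colored. The vertex to the left has at most one colored neighbor by the choice of the
  column, which leaves the other left corner uncolored; then the other vertex of the column cannot
  have three colored neighbors, hence has only one, which leaves the other right corner uncolored
  too. So none of the three neighbors has three colored neighbors. Hence the colored vertices of
  a minimal coloring form a $2$-independent set, and there are at least $k$ of them.

  For the value of $\beta_2$, two consecutive columns form a $4$-cycle, which contains at most two
  vertices of a $2$-independent set; taking both vertices of every odd column attains the bound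
  that results.
\<close>

section \<open>Degrees inside a vertex set\<close>

definition neighbors_in :: "'a pair_pre_digraph \<Rightarrow> 'a set \<Rightarrow> 'a \<Rightarrow> 'a set" where
  "neighbors_in G S v = {u \<in> S. (v, u) \<in> parcs G}"

lemma in_neighbors_in [simp]: "u \<in> neighbors_in G S v \<longleftrightarrow> u \<in> S \<and> (v, u) \<in> parcs G"
  by (simp add: neighbors_in_def)

lemma finite_neighbors_in [simp]: "finite S \<Longrightarrow> finite (neighbors_in G S v)"
  by (simp add: neighbors_in_def)

lemma two_independent_iff_card_neighbors_in:
  "two_independent G S \<longleftrightarrow> S \<subseteq> pverts G \<and> (\<forall>v \<in> S. card (neighbors_in G S v) \<le> 1)"
proof -
  have "out_degree (with_proj G \<restriction> S) v = card (neighbors_in G S v)" if "v \<in> S" for v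
  proof -
    have "out_arcs (with_proj G \<restriction> S) v = Pair v ` neighbors_in G S v"
      using that by (auto simp: out_arcs_def induce_subgraph_def)
    then show ?thesis
      by (simp add: out_degree_def card_image inj_on_def)
  qed
  then show ?thesis
    by (auto simp: two_independent_def)
qed

section \<open>Sub-quorum colorings in terms of friends\<close>

text \<open>
  A vertex belongs to its own closed neighborhood and has its own color, so $d$ colored neighbors
  with $m$ friends among them turn the quorum condition into $m + 1 \ge \frac12 (d + 1)$. Clearing
  denominators removes the real numbers.
\<close>

lemma sub_quorum_coloring_iff_card_neighbors_in:
  assumes "pair_graph G"
  shows "sub_quorum_coloring G k f \<longleftrightarrow> dom f \<subseteq> pverts G \<and> ran f = {1..k} \<and>
    (\<forall>v \<in> dom f. card (neighbors_in G (dom f) v)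
      \<le> 2 * card {u \<in> neighbors_in G (dom f) v. f u = f v} + 1)"
proof -
  interpret pair_graph G by fact
  have "real (card {u \<in> closed_neighborhood G v \<inter> dom f. f u = f v})
        \<ge> 1 / 2 * real (card (closed_neighborhood G v \<inter> dom f)) \<longleftrightarrow>
      card (neighbors_in G (dom f) v) \<le> 2 * card {u \<in> neighbors_in G (dom f) v. f u = f v} + 1"
    if sub: "dom f \<subseteq> pverts G" and v: "v \<in> dom f" for v
  proof -
    have fin: "finite (dom f)"
      using sub finite_subset pair_finite_verts by blast
    have loop: "(v, v) \<notin> parcs G"
      using no_loops' by blast
    have 1: "closed_neighborhood G v \<inter> dom f = insert v (neighbors_in G (dom f) v)"
      using sub v by (auto simp: closed_neighborhood_def)
    have 2: "{u \<in> closed_neighborhood G v \<inter> dom f. f u = f v}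
        = insert v {u \<in> neighbors_in G (dom f) v. f u = f v}"
      unfolding 1 by auto
    have "card {u \<in> closed_neighborhood G v \<inter> dom f. f u = f v}
        = Suc (card {u \<in> neighbors_in G (dom f) v. f u = f v})"
      unfolding 2 using fin loop by (subst card_insert_disjoint) auto
    moreover have "card (closed_neighborhood G v \<inter> dom f) = Suc (card (neighbors_in G (dom f) v))"
      unfolding 1 using fin loop by (subst card_insert_disjoint) auto
    ultimately show ?thesis
      by linarith
  qed
  then show ?thesis
    unfolding sub_quorum_coloring_def by blast
qed

text \<open>
  With $d \le 3$ colored neighbors, of which $m$ are friends, the condition $d \le 2m + 1$ can fail
  only if $m = 0$ and $d \ge 2$: a single friend is always enough.
\<close>

lemma sub_quorum_coloring_subcubic_iff:
  assumes G: "pair_graph G"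
    and subcubic: "\<And>v. card (neighbors_in G (pverts G) v) \<le> 3"
  shows "sub_quorum_coloring G k f \<longleftrightarrow> dom f \<subseteq> pverts G \<and> ran f = {1..k} \<and>
    (\<forall>v \<in> dom f. 2 \<le> card (neighbors_in G (dom f) v) \<longrightarrow>
      (\<exists>u \<in> neighbors_in G (dom f) v. f u = f v))"
proof -
  interpret pair_graph G by fact
  have "card (neighbors_in G (dom f) v) \<le> 2 * card {u \<in> neighbors_in G (dom f) v. f u = f v} + 1
      \<longleftrightarrow> (2 \<le> card (neighbors_in G (dom f) v) \<longrightarrow> (\<exists>u \<in> neighbors_in G (dom f) v. f u = f v))"
    if sub: "dom f \<subseteq> pverts G" for v
  proof -
    have "finite (dom f)"
      using sub finite_subset pair_finite_verts by blast
    then have fin: "finite {u \<in> neighbors_in G (dom f) v. f u = f v}"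
      by simp
    have "neighbors_in G (dom f) v \<subseteq> neighbors_in G (pverts G) v"
      using sub by (auto simp: neighbors_in_def)
    then have "card (neighbors_in G (dom f) v) \<le> 3"
      using subcubic[of v] card_mono[of "neighbors_in G (pverts G) v"] pair_finite_verts
      by (meson finite_neighbors_in order_trans)
    moreover have "card {u \<in> neighbors_in G (dom f) v. f u = f v} = 0 \<longleftrightarrow>
        \<not> (\<exists>u \<in> neighbors_in G (dom f) v. f u = f v)"
      unfolding card_0_eq[OF fin] by blast
    ultimately show ?thesis
      by (cases "card {u \<in> neighbors_in G (dom f) v. f u = f v} = 0") auto
  qed
  then show ?thesis
    unfolding sub_quorum_coloring_iff_card_neighbors_in[OF G] by blast
qed

text \<open>
  An injective coloring meets the condition $d \le 2m + 1$ with $m = 0$ exactly when every colored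
  vertex has $d \le 1$ colored neighbors.
\<close>

lemma two_independence_number_le_sub_quorum_number:
  assumes "pair_graph G"
  shows "two_independence_number G \<le> sub_quorum_number G"
proof -
  interpret pair_graph G by fact
  have le: "card S \<le> sub_quorum_number G" if S: "two_independent G S" for S
  proof -
    have sub: "S \<subseteq> pverts G" and deg: "\<forall>v \<in> S. card (neighbors_in G S v) \<le> 1"
      using S by (auto simp: two_independent_iff_card_neighbors_in)
    have "finite S"
      using sub finite_subset pair_finite_verts by blast
    then obtain h where h: "bij_betw h S {1..card S}"
      using bij_betw_iff_card[of S "{1..card S}"] by auto
    define f where "f = (\<lambda>v. if v \<in> S then Some (h v) else None)"
    have "dom f = S"
      by (auto simp: f_def dom_def)
    moreover have "ran f = {1..card S}"
      unfolding bij_betw_imp_surj_on[OF h, symmetric] by (auto simp: f_def ran_def)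
    ultimately have "sub_quorum_coloring G (card S) f"
      unfolding sub_quorum_coloring_iff_card_neighbors_in[OF assms]
      using sub deg trans_le_add2 by blast
    then show ?thesis
      unfolding sub_quorum_number_def
      using finite_sub_quorum_colors[OF pair_finite_verts] by (auto intro: Max_ge)
  qed
  show ?thesis
    unfolding two_independence_number_def
    by (rule Max.boundedI[OF finite_two_independent_cards[OF pair_finite_verts]
          two_independent_cards_nonempty]) (safe, rule le)
qed

section \<open>Colorings with the fewest colored vertices\<close>

text \<open>
  Since $v'$ keeps the color of $v$ alive, erasing $v$ preserves the number of colors, so by
  minimality it must destroy the condition at some vertex $u$. Erasing $v$ only lowers degrees, so
  $u$ suffers only by losing its last friend. After the loss $u$ still has at least two colored
  neighbors, and $v$ is a third.
\<close>

lemma minimal_coloring_critical_friend: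
  assumes G: "pair_graph G"
    and subcubic: "\<And>v. card (neighbors_in G (pverts G) v) \<le> 3"
    and f: "sub_quorum_coloring G k f"
    and minimal: "\<And>g. sub_quorum_coloring G k g \<Longrightarrow> card (dom f) \<le> card (dom g)"
    and v: "v \<in> dom f" "v' \<in> dom f" "v' \<noteq> v" "f v' = f v"
  shows "\<exists>u \<in> neighbors_in G (dom f) v. f u = f v \<and> 3 \<le> card (neighbors_in G (dom f) u) \<and>
    (\<forall>w \<in> neighbors_in G (dom f) u. f w = f u \<longrightarrow> w = v)"
proof -
  interpret pair_graph G by fact
  note iff = sub_quorum_coloring_subcubic_iff[OF G subcubic]
  have sub: "dom f \<subseteq> pverts G" and ran: "ran f = {1..k}"
    and friend: "\<And>x. x \<in> dom f \<Longrightarrow> 2 \<le> card (neighbors_in G (dom f) x)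
      \<Longrightarrow> \<exists>u \<in> neighbors_in G (dom f) x. f u = f x"
    using f by (auto simp: iff)
  have fin: "finite (dom f)"
    using sub finite_subset pair_finite_verts by blast
  define g where "g = f(v := None)"
  have dom_g: "dom g = dom f - {v}"
    by (auto simp: g_def)
  have "ran g = ran f"
  proof
    show "ran g \<subseteq> ran f"
      by (auto simp: g_def ran_def split: if_splits)
    show "ran f \<subseteq> ran g"
    proof
      fix c assume "c \<in> ran f"
      then obtain x where x: "f x = Some c"
        by (auto simp: ran_def)
      have "g (if x = v then v' else x) = Some c"
        using x v by (auto simp: g_def)
      then show "c \<in> ran g"
        by (rule ranI)
    qed
  qed
  moreover have "\<not> sub_quorum_coloring G k g"
    using minimal[of g] card_Diff1_less[OF fin v(1)] by (auto simp: dom_g)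
  ultimately obtain u where u: "u \<in> dom g" and deg: "2 \<le> card (neighbors_in G (dom g) u)"
    and no_friend: "\<And>w. w \<in> neighbors_in G (dom g) u \<Longrightarrow> g w \<noteq> g u"
    using sub ran unfolding iff dom_g by blast
  have u': "u \<in> dom f" "u \<noteq> v"
    using u by (auto simp: dom_g)
  have nb: "neighbors_in G (dom g) u = neighbors_in G (dom f) u - {v}"
    by (auto simp: dom_g)
  \<comment> \<open>The color of a neighbor other than \<open>v\<close> survives the erasure, so a friend of \<open>u\<close>
    other than \<open>v\<close> would still be one.\<close>
  have only: "w = v" if "w \<in> neighbors_in G (dom f) u" "f w = f u" for w
    using no_friend[of w] that u' by (auto simp: nb g_def split: if_splits)
  have le: "card (neighbors_in G (dom g) u) \<le> card (neighbors_in G (dom f) u)"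
    unfolding nb using fin by (intro card_mono) auto
  obtain w where w: "w \<in> neighbors_in G (dom f) u" "f w = f u"
    using friend[OF u'(1)] deg le by auto
  then have [simp]: "w = v"
    using only by blast
  have "card (neighbors_in G (dom g) u) = card (neighbors_in G (dom f) u) - 1"
    unfolding nb using w fin by (simp add: card_Diff_singleton)
  then have "3 \<le> card (neighbors_in G (dom f) u)"
    using deg by linarith
  moreover have "u \<in> neighbors_in G (dom f) v"
    using w(1) u' arcs_symmetric[of u v] by simp
  ultimately show ?thesis
    using w(2) only by (intro bexI[of _ u]) simp_all
qed

text \<open>
  Apply the preceding lemma to $v$ to obtain a critical friend $u$, and then to $u$. The second
  application yields a friend of $u$ with three colored neighbors, and the only friend of $u$ is
  $v$.
\<close>

lemma minimal_coloring_degree_two_imp_three: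
  assumes G: "pair_graph G"
    and subcubic: "\<And>v. card (neighbors_in G (pverts G) v) \<le> 3"
    and f: "sub_quorum_coloring G k f"
    and minimal: "\<And>g. sub_quorum_coloring G k g \<Longrightarrow> card (dom f) \<le> card (dom g)"
    and v: "v \<in> dom f" "2 \<le> card (neighbors_in G (dom f) v)"
  shows "3 \<le> card (neighbors_in G (dom f) v) \<and>
    (\<exists>u \<in> neighbors_in G (dom f) v. 3 \<le> card (neighbors_in G (dom f) u))"
proof -
  interpret pair_graph G by fact
  note M = minimal_coloring_critical_friend[OF G subcubic f minimal]
  obtain v' where v': "v' \<in> neighbors_in G (dom f) v" "f v' = f v"
    using f v by (auto simp: sub_quorum_coloring_subcubic_iff[OF G subcubic])
  have "v' \<noteq> v"
    using v' no_loops' by auto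
  with v v' obtain u where u: "u \<in> neighbors_in G (dom f) v" "f u = f v"
      "3 \<le> card (neighbors_in G (dom f) u)"
      "\<forall>w \<in> neighbors_in G (dom f) u. f w = f u \<longrightarrow> w = v"
    using M[of v v'] by auto
  have "u \<noteq> v"
    using u no_loops' by auto
  with u v obtain w where w: "w \<in> neighbors_in G (dom f) u" "f w = f u"
      "3 \<le> card (neighbors_in G (dom f) w)"
    using M[of u v] by auto
  then have "w = v"
    using u by blast
  with u w show ?thesis
    by blast
qed

section \<open>Ladders\<close>

lemma pverts_ladder: "pverts (grid_graph 2 n) = {1, 2} \<times> {1..n}"
  by (auto simp: grid_graph_def cartesian_product_def path_graph_def)

lemma parcs_ladder:
  "((r, c), (r', c')) \<in> parcs (grid_graph 2 n) \<longleftrightarrow>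
    r \<in> {1, 2} \<and> r' \<in> {1, 2} \<and> c \<in> {1..n} \<and> c' \<in> {1..n} \<and>
    (r = r' \<and> (c' = c + 1 \<or> c = c' + 1) \<or> c = c' \<and> r \<noteq> r')"
  by (auto simp: grid_graph_def cartesian_product_def path_graph_def)

lemma finite_verts_ladder: "finite (pverts (grid_graph 2 n))"
  by (simp add: pverts_ladder)

lemma neighbors_in_ladder_subset:
  "neighbors_in (grid_graph 2 n) S (r, c) \<subseteq> {(3 - r, c), (r, c - 1), (r, c + 1)}"
  by (auto simp: parcs_ladder)

lemma subcubic_ladder: "card (neighbors_in (grid_graph 2 n) S v) \<le> 3"
proof (cases v)
  case (Pair r c)
  have "card (neighbors_in (grid_graph 2 n) S v) \<le> card {(3 - r, c), (r, c - 1), (r, c + 1)}"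
    unfolding Pair by (intro card_mono neighbors_in_ladder_subset) simp
  also have "\<dots> \<le> 3"
    by (simp add: card_insert_if)
  finally show ?thesis .
qed

lemma two_neighborsI:
  assumes "finite S" "a \<in> neighbors_in G S v" "b \<in> neighbors_in G S v" "a \<noteq> b"
  shows "2 \<le> card (neighbors_in G S v)"
proof -
  have "card {a, b} \<le> card (neighbors_in G S v)"
    using assms by (intro card_mono) auto
  then show ?thesis
    using assms by simp
qed

lemma three_neighbors_ladderD:
  assumes "3 \<le> card (neighbors_in (grid_graph 2 n) S (r, c))"
  shows "(3 - r, c) \<in> neighbors_in (grid_graph 2 n) S (r, c)"
    "(r, c - 1) \<in> neighbors_in (grid_graph 2 n) S (r, c)"
    "(r, c + 1) \<in> neighbors_in (grid_graph 2 n) S (r, c)"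
proof -
  have "neighbors_in (grid_graph 2 n) S (r, c) = {(3 - r, c), (r, c - 1), (r, c + 1)}"
    using assms by (intro card_seteq neighbors_in_ladder_subset) (auto simp: card_insert_if)
  then show "(3 - r, c) \<in> neighbors_in (grid_graph 2 n) S (r, c)"
    "(r, c - 1) \<in> neighbors_in (grid_graph 2 n) S (r, c)"
    "(r, c + 1) \<in> neighbors_in (grid_graph 2 n) S (r, c)"
    by blast+
qed

text \<open>
  A leftmost vertex $x = (r, c)$ with two neighbors in $S$ would have three. The two corners
  $(s, c - 1)$ and $(s, c + 1)$ in the other row $s$ are then both excluded from $S$, and each of
  the three neighbors of $x$ is adjacent to one of them, hence has at most two neighbors in $S$.
  This contradicts the existence of a neighbor of $x$ with three.
\<close>

lemma ladder_no_degree_three_cluster: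
  assumes sub: "S \<subseteq> pverts (grid_graph 2 n)"
    and degrees: "\<And>v. v \<in> S \<Longrightarrow> 2 \<le> card (neighbors_in (grid_graph 2 n) S v) \<Longrightarrow>
      3 \<le> card (neighbors_in (grid_graph 2 n) S v) \<and>
      (\<exists>u \<in> neighbors_in (grid_graph 2 n) S v. 3 \<le> card (neighbors_in (grid_graph 2 n) S u))"
    and "v \<in> S"
  shows "card (neighbors_in (grid_graph 2 n) S v) \<le> 1"
proof (rule ccontr)
  let ?N = "neighbors_in (grid_graph 2 n) S"
  assume v: "\<not> card (?N v) \<le> 1"
  have fin: "finite S"
    using sub finite_verts_ladder finite_subset by blast
  let ?P = "\<lambda>x. x \<in> S \<and> 2 \<le> card (?N x)"
  obtain x where x: "?P x" and leftmost: "\<And>y. ?P y \<Longrightarrow> snd x \<le> snd y"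
    using v \<open>v \<in> S\<close> ex_has_least_nat[of ?P v snd] by auto
  obtain r c where [simp]: "x = (r, c)"
    by (cases x)
  define s where "s = 3 - r"
  have deg: "3 \<le> card (?N (r, c))"
    and friend: "\<exists>u \<in> ?N (r, c). 3 \<le> card (?N u)"
    using degrees[of x] x by auto
  note nbs = three_neighbors_ladderD[OF deg, folded s_def]
  have rows: "r \<in> {1, 2}" "s \<in> {1, 2}" "s \<noteq> r" "3 - s = r" and cols: "1 \<le> c - 1" "c + 1 \<le> n"
    using nbs by (auto simp: parcs_ladder s_def)
  have left: "\<not> 2 \<le> card (?N (r, c - 1))"
    using leftmost[of "(r, c - 1)"] nbs cols by auto
  have "(s, c - 1) \<notin> S"
  proof
    assume "(s, c - 1) \<in> S"
    then have "2 \<le> card (?N (r, c - 1))"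
      using rows cols nbs x
      by (intro two_neighborsI[OF fin, of "(s, c - 1)" _ _ "(r, c)"]) (auto simp: parcs_ladder)
    with left show False ..
  qed
  \<comment> \<open>This corner was the left neighbor of \<open>(s, c)\<close>.\<close>
  then have vert3: "\<not> 3 \<le> card (?N (s, c))"
    using three_neighbors_ladderD(2)[of n S s c] by auto
  have "(s, c + 1) \<notin> S"
  proof
    assume "(s, c + 1) \<in> S"
    then have "2 \<le> card (?N (s, c))"
      using rows cols nbs x
      by (intro two_neighborsI[OF fin, of "(s, c + 1)" _ _ "(r, c)"]) (auto simp: parcs_ladder)
    with vert3 degrees[of "(s, c)"] nbs show False
      by auto
  qed
  \<comment> \<open>This corner was the vertical neighbor of \<open>(r, c + 1)\<close>.\<close>
  then have right3: "\<not> 3 \<le> card (?N (r, c + 1))"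
    using three_neighbors_ladderD(1)[of n S r "c + 1"] by (auto simp: s_def)
  from friend obtain u where u: "u \<in> ?N (r, c)" "3 \<le> card (?N u)"
    by blast
  then have "u \<in> {(s, c), (r, c - 1), (r, c + 1)}"
    using neighbors_in_ladder_subset s_def by blast
  with u left vert3 right3 show False
    by auto
qed

text \<open>
  The domain of a coloring with $k$ colors and the fewest colored vertices is $2$-independent, and
  it has at least $k$ elements.
\<close>

lemma sub_quorum_number_ladder_le:
  "sub_quorum_number (grid_graph 2 n) \<le> two_independence_number (grid_graph 2 n)"
proof -
  let ?G = "grid_graph 2 n"
  note G = pair_graph_grid_graph[of 2 n]
  have le: "k \<le> two_independence_number ?G" if ex: "\<exists>f. sub_quorum_coloring ?G k f" for k
  proof -
    obtain f where f: "sub_quorum_coloring ?G k f"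
      and minimal: "\<And>g. sub_quorum_coloring ?G k g \<Longrightarrow> card (dom f) \<le> card (dom g)"
      using ex ex_has_least_nat[of "sub_quorum_coloring ?G k" _ "\<lambda>g. card (dom g)"] by blast
    have sub: "dom f \<subseteq> pverts ?G" and ran: "ran f = {1..k}"
      using f by (auto simp: sub_quorum_coloring_def)
    have fin: "finite (dom f)"
      using sub finite_verts_ladder finite_subset by blast
    have "card (neighbors_in ?G (dom f) v) \<le> 1" if "v \<in> dom f" for v
      using sub minimal_coloring_degree_two_imp_three[OF G subcubic_ladder f minimal] that
      by (rule ladder_no_degree_three_cluster)
    then have "two_independent ?G (dom f)"
      using sub by (simp add: two_independent_iff_card_neighbors_in)
    then have "card (dom f) \<le> two_independence_number ?G"
      unfolding two_independence_number_def
      using finite_two_independent_cards[OF finite_verts_ladder] by (auto intro: Max_ge)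
    moreover have "ran f = (the \<circ> f) ` dom f"
      by (force simp: ran_def dom_def)
    then have "k \<le> card (dom f)"
      using ran card_image_le[OF fin, of "the \<circ> f"] by (metis card_atLeastAtMost diff_Suc_1)
    ultimately show ?thesis
      by linarith
  qed
  show ?thesis
    unfolding sub_quorum_number_def
    by (rule Max.boundedI[OF finite_sub_quorum_colors[OF finite_verts_ladder]
          sub_quorum_colors_nonempty]) (rule le, simp)
qed

section \<open>The 2-independence number of a ladder\<close>

text \<open>
  Three vertices of a $4$-cycle form a path, whose middle vertex has two neighbors.
\<close>

lemma two_independent_four_cycle:
  assumes "pair_graph G" "two_independent G S"
    and cycle: "(a, b) \<in> parcs G" "(b, c) \<in> parcs G" "(c, d) \<in> parcs G" "(d, a) \<in> parcs G"
    and "a \<noteq> c" "b \<noteq> d"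
  shows "card (S \<inter> {a, b, c, d}) \<le> 2"
proof -
  interpret pair_graph G by fact
  have fin: "finite S"
    using assms(2) finite_subset pair_finite_verts unfolding two_independent_def by blast
  have no_path: "\<not> (x \<in> S \<and> y \<in> S \<and> z \<in> S)"
    if "(x, y) \<in> parcs G" "(y, z) \<in> parcs G" "x \<noteq> z" for x y z
  proof
    assume "x \<in> S \<and> y \<in> S \<and> z \<in> S"
    then have "2 \<le> card (neighbors_in G S y)"
      using that arcs_symmetric[of x y] by (intro two_neighborsI[OF fin, of x _ _ z]) simp_all
    with assms(2) \<open>x \<in> S \<and> y \<in> S \<and> z \<in> S\<close> show False
      by (fastforce simp: two_independent_iff_card_neighbors_in)
  qed
  have "\<not> (a \<in> S \<and> b \<in> S \<and> c \<in> S)" "\<not> (b \<in> S \<and> c \<in> S \<and> d \<in> S)"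
    "\<not> (c \<in> S \<and> d \<in> S \<and> a \<in> S)" "\<not> (d \<in> S \<and> a \<in> S \<and> b \<in> S)"
    using no_path cycle assms(7,8) by blast+
  then consider "S \<inter> {a, b, c, d} \<subseteq> {a, b}" | "S \<inter> {a, b, c, d} \<subseteq> {b, c}"
    | "S \<inter> {a, b, c, d} \<subseteq> {c, d}" | "S \<inter> {a, b, c, d} \<subseteq> {d, a}"
    | "S \<inter> {a, b, c, d} \<subseteq> {a, c}" | "S \<inter> {a, b, c, d} \<subseteq> {b, d}"
    by blast
  then obtain x y where "S \<inter> {a, b, c, d} \<subseteq> {x, y}"
    by cases blast+
  then have "card (S \<inter> {a, b, c, d}) \<le> card {x, y}"
    by (intro card_mono) simp_all
  also have "\<dots> \<le> 2"
    by (simp add: card_insert_if)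
  finally show ?thesis .
qed

text \<open>
  The blocks of columns $2j + 1$ and $2j + 2$ with $j < \lceil n/2 \rceil$ cover the ladder. All of
  them are $4$-cycles, except that for odd $n$ the last block is cut down to a single column, which
  has only two vertices.
\<close>

lemma two_independent_ladder_card_le:
  assumes S: "two_independent (grid_graph 2 n) S"
  shows "card S \<le> 2 * ((n + 1) div 2)"
proof -
  define B where "B j = ({1, 2} \<times> {2 * j + 1, 2 * j + 2} :: (nat \<times> nat) set)" for j :: nat
  have sub: "S \<subseteq> {1, 2} \<times> {1..n}"
    using S by (simp add: two_independent_def pverts_ladder)
  have block: "card (S \<inter> B j) \<le> 2" if "j < (n + 1) div 2" for j
  proof (cases "2 * j + 2 \<le> n")
    case True
    have "card (S \<inter> {(1, 2 * j + 1), (1, 2 * j + 2), (2, 2 * j + 2), (2, 2 * j + 1)}) \<le> 2"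
      using True
      by (intro two_independent_four_cycle[OF pair_graph_grid_graph S]) (auto simp: parcs_ladder)
    moreover have "B j = {(1, 2 * j + 1), (1, 2 * j + 2), (2, 2 * j + 2), (2, 2 * j + 1)}"
      by (auto simp: B_def)
    ultimately show ?thesis
      by simp
  next
    case False
    then have "S \<inter> B j \<subseteq> {(1, 2 * j + 1), (2, 2 * j + 1)}"
      using sub by (auto simp: B_def)
    then have "card (S \<inter> B j) \<le> card {(1 :: nat, 2 * j + 1), (2, 2 * j + 1)}"
      by (intro card_mono) auto
    then show ?thesis
      by simp
  qed
  have "S \<subseteq> (\<Union>j<(n + 1) div 2. S \<inter> B j)"
  proof
    fix v assume v: "v \<in> S"
    then obtain r c where rc: "v = (r, c)" "r \<in> {1, 2}" "1 \<le> c" "c \<le> n"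
      using sub by auto
    then have "v \<in> B ((c - 1) div 2)" "(c - 1) div 2 < (n + 1) div 2"
      by (auto simp: B_def)
    with v show "v \<in> (\<Union>j<(n + 1) div 2. S \<inter> B j)"
      by blast
  qed
  then have "card S \<le> card (\<Union>j<(n + 1) div 2. S \<inter> B j)"
    by (intro card_mono) (auto simp: B_def)
  also have "\<dots> \<le> (\<Sum>j<(n + 1) div 2. card (S \<inter> B j))"
    by (intro card_UN_le) simp
  also have "\<dots> \<le> (\<Sum>j<(n + 1) div 2. 2)"
    using block by (intro sum_mono) simp
  finally show ?thesis
    by simp
qed

lemma odd_columns_two_independent:
  "two_independent (grid_graph 2 n) ({1, 2} \<times> (\<lambda>j. 2 * j + 1) ` {..<(n + 1) div 2})"
    (is "two_independent _ ?S")
proof -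
  have "card (neighbors_in (grid_graph 2 n) ?S v) \<le> 1" if "v \<in> ?S" for v
  proof -
    from that obtain r j where v: "v = (r, 2 * j + 1)"
      by auto
    have "neighbors_in (grid_graph 2 n) ?S v \<subseteq> {(3 - r, 2 * j + 1)}"
    proof
      fix u assume u: "u \<in> neighbors_in (grid_graph 2 n) ?S v"
      obtain r' c where rc: "u = (r', c)"
        by (cases u)
      \<comment> \<open>Horizontal neighbors lie in columns of different parity, so only the vertical
        neighbor is left.\<close>
      have "odd c"
        using u rc by auto
      then have "c \<noteq> 2 * j + 1 + 1" "2 * j + 1 \<noteq> c + 1"
        by presburger+
      with u show "u \<in> {(3 - r, 2 * j + 1)}"
        unfolding v rc by (auto simp: parcs_ladder simp del: mem_Sigma_iff)
    qed
    then have "card (neighbors_in (grid_graph 2 n) ?S v) \<le> card {(3 - r, 2 * j + 1)}"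
      by (intro card_mono) auto
    then show ?thesis
      by simp
  qed
  then show ?thesis
    unfolding two_independent_iff_card_neighbors_in by (auto simp: pverts_ladder)
qed

lemma two_independence_number_ladder:
  "two_independence_number (grid_graph 2 n) = 2 * ((n + 1) div 2)"
  unfolding two_independence_number_def
proof (rule Max_eqI)
  show "finite {card S |S. two_independent (grid_graph 2 n) S}"
    by (rule finite_two_independent_cards[OF finite_verts_ladder])
  show "y \<le> 2 * ((n + 1) div 2)" if "y \<in> {card S |S. two_independent (grid_graph 2 n) S}" for y
    using that two_independent_ladder_card_le by blast
  have "card ({1 :: nat, 2} \<times> (\<lambda>j. 2 * j + 1 :: nat) ` {..<(n + 1) div 2}) = 2 * ((n + 1) div 2)"
    by (simp add: card_cartesian_product card_image inj_on_def)
  with odd_columns_two_independent[of n]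
  show "2 * ((n + 1) div 2) \<in> {card S |S. two_independent (grid_graph 2 n) S}"
    by (metis (mono_tags, lifting) mem_Collect_eq)
qed

theorem theorem5p3:
  fixes n :: nat
  assumes "n \<ge> 1"
  shows "sub_quorum_number (grid_graph 2 n) = two_independence_number (grid_graph 2 n) \<and>
    int (two_independence_number (grid_graph 2 n)) = 2 * \<lceil>real n / 2\<rceil>"
proof
  show "sub_quorum_number (grid_graph 2 n) = two_independence_number (grid_graph 2 n)"
    using sub_quorum_number_ladder_le
      two_independence_number_le_sub_quorum_number[OF pair_graph_grid_graph] by (rule antisym)
  have "\<lceil>real n / 2\<rceil> = int ((n + 1) div 2)"
    by linarith
  then show "int (two_independence_number (grid_graph 2 n)) = 2 * \<lceil>real n / 2\<rceil>"
    by (simp add: two_independence_number_ladder)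
qed

end
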